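(* If $G$ is a finite planar graph with maximum degree $\Delta(G)$, then $ub(G)\le \lceil (\Delta(G)+1)/3\rceil+2$.
   Context: A bar is a closed horizontal line segment of length $1$ in the plane. Two bars of an arrangement of pairwise disjoint bars see each other if there is an axis-parallel rectangle of positive width whose bottom side lies in one of them, whose top side lies in the other, and whose interior meets no bar of the arrangement. For a nonnegative integer $t$, a $t$-unit-bar visibility representation of a graph $G$ assigns to each vertex a set of at most $t$ bars, all bars pairwise disjoint, such that two distinct vertices are adjacent iff some bar of one sees some bar of the other; $ub(G)$ is the minimum such $t$. *)

theory Defs
  imports
    "HOL-Analysis.Analysis"
    "HOL-Library.Extended_Nat"
    "Graph_Theory.Pair_Digraph"
begin

(* A finite simple graph is a pair_graph: a finite loopfree pair digraph whose arc relation is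
   symmetric, so that each edge uv is present as the two arcs (u,v) and (v,u). *)

(* Each vertex is the tail of exactly one arc per neighbour, so the out-degree is the degree.
   The inserted 0 only matters for the graph without vertices. *)
definition max_degree :: "'a pair_pre_digraph \<Rightarrow> nat" where
  "max_degree G = Max (insert 0 (out_degree (with_proj G) ` pverts G))"

definition undirected_edges :: "'a pair_pre_digraph \<Rightarrow> 'a set set" where
  "undirected_edges G = {{u, v} | u v. (u, v) \<in> parcs G}"

(* The plane is identified with the type complex here. *)
definition plane_drawing ::
  "'a pair_pre_digraph \<Rightarrow> ('a \<Rightarrow> complex) \<Rightarrow> ('a set \<Rightarrow> real \<Rightarrow> complex) \<Rightarrow> bool" where
  "plane_drawing G pos \<gamma> \<longleftrightarrow>
     inj_on pos (pverts G) \<and>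
     (\<forall>e\<in>undirected_edges G.
        arc (\<gamma> e) \<and>
        {pathstart (\<gamma> e), pathfinish (\<gamma> e)} = pos ` e \<and>
        path_image (\<gamma> e) \<inter> pos ` pverts G = pos ` e) \<and>
     (\<forall>e\<in>undirected_edges G. \<forall>e'\<in>undirected_edges G. e \<noteq> e' \<longrightarrow>
        path_image (\<gamma> e) \<inter> path_image (\<gamma> e') \<subseteq> pos ` (e \<inter> e'))"

definition planar :: "'a pair_pre_digraph \<Rightarrow> bool" where
  "planar G \<longleftrightarrow> (\<exists>pos \<gamma>. plane_drawing G pos \<gamma>)"

definition unit_bar :: "(real \<times> real) set \<Rightarrow> bool" where
  "unit_bar B \<longleftrightarrow> (\<exists>x y. B = {x..x + 1} \<times> {y})"

(* The arrangement is the set \<B> of all bars; the rectangle is {l..r} \<times> {b..t}, and its height is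
   automatically positive when A and B are disjoint. *)
definition bars_see :: "(real \<times> real) set set \<Rightarrow> (real \<times> real) set \<Rightarrow> (real \<times> real) set \<Rightarrow> bool" where
  "bars_see \<B> A B \<longleftrightarrow>
     (\<exists>l r b t. l < r \<and> b < t \<and>
        ({l..r} \<times> {b} \<subseteq> A \<and> {l..r} \<times> {t} \<subseteq> B \<or> {l..r} \<times> {b} \<subseteq> B \<and> {l..r} \<times> {t} \<subseteq> A) \<and>
        (\<forall>C\<in>\<B>. interior ({l..r} \<times> {b..t}) \<inter> C = {}))"

(* Disjointness is required for any two bars that differ as bars or belong to different vertices;
   in particular no bar is assigned to two vertices. *)
definition unit_bar_visibility_rep ::
  "nat \<Rightarrow> 'a pair_pre_digraph \<Rightarrow> ('a \<Rightarrow> (real \<times> real) set set) \<Rightarrow> bool" where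
  "unit_bar_visibility_rep t G bars \<longleftrightarrow>
     (\<forall>v\<in>pverts G. finite (bars v) \<and> card (bars v) \<le> t \<and> (\<forall>B\<in>bars v. unit_bar B)) \<and>
     (\<forall>u\<in>pverts G. \<forall>v\<in>pverts G. \<forall>A\<in>bars u. \<forall>B\<in>bars v. (u, A) \<noteq> (v, B) \<longrightarrow> A \<inter> B = {}) \<and>
     (\<forall>u\<in>pverts G. \<forall>v\<in>pverts G. u \<noteq> v \<longrightarrow>
        ((u, v) \<in> parcs G \<longleftrightarrow>
         (\<exists>A\<in>bars u. \<exists>B\<in>bars v. bars_see (\<Union>w\<in>pverts G. bars w) A B)))"

(* The infimum in enat is the minimum whenever a representation exists, and \<infinity> otherwise. *)
definition ub :: "'a pair_pre_digraph \<Rightarrow> enat" where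
  "ub G = Inf {enat t | t. \<exists>bars. unit_bar_visibility_rep t G bars}"

end

theory Submission
  imports Defs
begin

text \<open>Euler's formula gives every subgraph of a planar graph at most three times as many edges as
  vertices, so by Hall's theorem the edges can be oriented with out-degrees at most 3. A single bar
  of \<open>v\<close> sees three leaf bars (two above, one below) and nothing else, so the in-edges of \<open>v\<close> cost a
  third of a bar each and the at most three out-edges one bar each.

  For Euler's inequality, the number of regions grows whenever a new arc closes a Jordan curve, each
  edge lies on the boundary of at most two regions, and each region has at least three edges on its
  boundary.\<close>

section \<open>Complementary regions of arcs in the plane\<close>

text \<open>Unit length limits a star to three leaves. Two disjoint unit bars at one height that
  both overlap a unit centre must overhang it on opposite sides; a second such pair on the other
  side would see the first past the ends of the centre. A single leaf exactly under the centre is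
  screened off from the upper ones. For the edge count one-sided estimates suffice: with n vertices,
  m \<ge> 3 edges and r regions, m \<le> r + n and 3r \<le> 2m give m \<le> 3n, for disconnected
  drawings as well. Boundaries of regions enter only as point sets: an edge counts as lying on the
  boundary of a region if the closure of the region meets the edge off its ends.\<close>

lemma card_image_coarser:
  assumes "finite (f ` X)" "\<And>x y. x \<in> X \<Longrightarrow> y \<in> X \<Longrightarrow> f x = f y \<Longrightarrow> g x = g y"
  shows card_image_coarser_le: "card (g ` X) \<le> card (f ` X)"
    and card_image_coarser_less:
      "u \<in> X \<Longrightarrow> v \<in> X \<Longrightarrow> f u \<noteq> f v \<Longrightarrow> g u = g v \<Longrightarrow> card (g ` X) < card (f ` X)"
    and finite_image_coarser: "finite (g ` X)"
proof -
  \<comment> \<open>On \<open>X\<close> the map \<open>g\<close> factors through \<open>f\<close>,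
    with \<open>h\<close> as second factor. The count drops when \<open>h\<close> merges two
    values.\<close>
  define h where "h c = g (SOME x. x \<in> X \<and> f x = c)" for c
  have h: "h (f x) = g x" if "x \<in> X" for x
  proof -
    have "(SOME y. y \<in> X \<and> f y = f x) \<in> X \<and> f (SOME y. y \<in> X \<and> f y = f x) = f x"
      by (rule someI[of _ x]) (use that in simp)
    then show ?thesis
      unfolding h_def using assms(2) that by blast
  qed
  then have gh: "g ` X = h ` f ` X"
    by (force simp: image_iff)
  then show le: "card (g ` X) \<le> card (f ` X)"
    by (simp add: assms(1) card_image_le)
  show "finite (g ` X)"
    using gh assms(1) by simp
  assume uv: "u \<in> X" "v \<in> X" "f u \<noteq> f v" "g u = g v"
  have "\<not> inj_on h (f ` X)"
    using uv h by (metis imageI inj_on_def)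
  then have "card (h ` f ` X) \<noteq> card (f ` X)"
    using assms(1) eq_card_imp_inj_on by blast
  with le gh show "card (g ` X) < card (f ` X)"
    by simp
qed

text \<open>Otherwise the inverse homeomorphism would embed a nonempty open subset of the plane into
  the line, against invariance of dimension.\<close>

lemma interior_arc_image:
  fixes g :: "real \<Rightarrow> complex"
  assumes "arc g"
  shows "interior (path_image g) = {}"
proof (rule ccontr)
  assume ne: "interior (path_image g) \<noteq> {}"
  obtain h where h: "homeomorphism {0..1} (path_image g) g h"
    using homeomorphism_arc[OF assms] by blast
  have "DIM(complex) \<le> DIM(real)"
  proof (rule invariance_of_dimension)
    show "continuous_on (interior (path_image g)) h"
      using homeomorphism_cont2[OF h] interior_subset by (rule continuous_on_subset)
    show "inj_on h (interior (path_image g))"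
      by (rule inj_on_subset[OF _ interior_subset]) (metis h homeomorphism_apply2 inj_on_inverseI)
  qed (use ne in auto)
  then show False by simp
qed

lemma frontier_arc_image:
  fixes g :: "real \<Rightarrow> complex"
  assumes "arc g"
  shows "frontier (path_image g) = path_image g"
  using assms closed_arc_image[of g] interior_arc_image[of g] by (simp add: frontier_def)

lemma inter_Diff_arc_image_nonempty:
  fixes g :: "real \<Rightarrow> complex"
  assumes "open U" "U \<noteq> {}" "arc g"
  shows "U - path_image g \<noteq> {}"
  using assms interior_arc_image[of g] by (metis Diff_eq_empty_iff interior_maximal subset_empty)

definition open_arc :: "(real \<Rightarrow> complex) \<Rightarrow> complex set" where
  "open_arc g = g ` {0<..<1}"

lemma open_arc_eq:
  assumes "arc g"
  shows "open_arc g = path_image g - {pathstart g, pathfinish g}"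
proof -
  have "open_arc g = g ` ({0..1} - {0, 1})"
    unfolding open_arc_def by (rule arg_cong[of _ _ "image g"]) auto
  also have "\<dots> = g ` {0..1} - g ` {0, 1}"
    using assms by (intro inj_on_image_set_diff[of g "{0..1}"]) (auto simp: arc_def)
  finally show ?thesis
    by (simp add: path_image_def pathstart_def pathfinish_def)
qed

lemma open_arc_nonempty: "open_arc g \<noteq> {}"
  by (simp add: open_arc_def)

lemma open_arc_subset: "open_arc g \<subseteq> path_image g"
  by (auto simp: open_arc_def path_image_def)

text \<open>By \<open>dense\<close>, every component of \<open>- K\<close>, being open, keeps a
  point off \<open>K'\<close>. The components of both complements are then images of the same set
  \<open>- K'\<close> under their component maps, and the map for \<open>K\<close> is the coarser
  one.\<close>

lemma components_Compl_superset:
  fixes K K' :: "complex set"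
  assumes "K \<subseteq> K'" "closed K" and dense: "\<And>U. open U \<Longrightarrow> U \<noteq> {} \<Longrightarrow> U \<subseteq> - K \<Longrightarrow> U - K' \<noteq> {}"
    and fin: "finite (components (- K'))"
  shows finite_components_Compl_subset: "finite (components (- K))"
    and card_components_Compl_le: "card (components (- K)) \<le> card (components (- K'))"
    and card_components_Compl_less:
      "x \<notin> K' \<Longrightarrow> y \<notin> K' \<Longrightarrow> connected_component (- K) x y \<Longrightarrow> \<not> connected_component (- K') x y
        \<Longrightarrow> card (components (- K)) < card (components (- K'))"
proof -
  let ?f = "connected_component_set (- K')" and ?g = "connected_component_set (- K)"
  have K': "components (- K') = ?f ` (- K')"
    by (simp add: components_def)
  have K: "components (- K) = ?g ` (- K')"
  proof
    show "components (- K) \<subseteq> ?g ` (- K')"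
    proof
      fix C assume C: "C \<in> components (- K)"
      then have "open C" "C \<noteq> {}" "C \<subseteq> - K"
        using assms(2) open_components in_components_nonempty in_components_subset by blast+
      then obtain x where x: "x \<in> C" "x \<notin> K'"
        using dense by blast
      then have "C = ?g x"
        using C by (metis componentsE connected_component_eq)
      with x show "C \<in> ?g ` (- K')" by blast
    qed
    show "?g ` (- K') \<subseteq> components (- K)"
      using assms(1) by (auto simp: components_def)
  qed
  have coarse: "?g x = ?g y" if "x \<in> - K'" "y \<in> - K'" "?f x = ?f y" for x y
  proof -
    have "connected_component (- K') x y"
      using that connected_component_refl by (metis mem_Collect_eq)
    then have "connected_component (- K) x y"
      by (rule connected_component_of_subset) (use assms(1) in auto)
    then show ?thesis
      by (simp add: connected_component_eq)
  qed
  note * = fin[unfolded K'] coarse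
  show "finite (components (- K))"
    unfolding K by (rule finite_image_coarser[of ?f, OF *])
  show "card (components (- K)) \<le> card (components (- K'))"
    unfolding K K' by (rule card_image_coarser_le[of ?f, OF *])
  assume xy: "x \<notin> K'" "y \<notin> K'" "connected_component (- K) x y" "\<not> connected_component (- K') x y"
  show "card (components (- K)) < card (components (- K'))"
    unfolding K K'
  proof (rule card_image_coarser_less[of ?f, OF *])
    show "?f x \<noteq> ?f y"
      using xy by (metis ComplI connected_component_refl mem_Collect_eq)
    show "?g x = ?g y"
      using xy by (simp add: connected_component_eq)
  qed (use xy in auto)
qed

text \<open>An arc \<open>h\<close> in \<open>K\<close> closes \<open>g\<close> to a Jordan curve. A
  point of the open arc is a boundary point of both inside and outside, so a ball about it that
  misses \<open>K\<close> contains points of both sides: joined off \<open>K\<close>, but separated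
  once \<open>g\<close> is added.\<close>

lemma card_components_Compl_Un_arc:
  fixes K :: "complex set"
  assumes "closed K" "arc g" and Kg: "K \<inter> path_image g = {pathstart g, pathfinish g}"
    and conn: "path_component K (pathfinish g) (pathstart g)"
    and fin: "finite (components (- (K \<union> path_image g)))"
  shows "card (components (- K)) < card (components (- (K \<union> path_image g)))"
proof -
  obtain q where q: "path q" "path_image q \<subseteq> K" "pathstart q = pathfinish g" "pathfinish q = pathstart g"
    using conn by (auto simp: path_component_def)
  have "pathfinish g \<noteq> pathstart g"
    using assms(2) arc_distinct_ends by metis
  then obtain h where h: "arc h" "path_image h \<subseteq> K" "pathstart h = pathfinish g" "pathfinish h = pathstart g"
    using path_contains_arc[OF q(1,3,4)] q(2) by (metis subset_trans)
  have simple: "simple_path (g +++ h)"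
    by (rule simple_path_join_loop) (use assms h in auto)
  let ?J = "path_image (g +++ h)"
  have J: "?J = path_image g \<union> path_image h"
    using h by (simp add: path_image_join)
  note Jordan = Jordan_inside_outside[OF simple, simplified h pathfinish_join pathstart_join, simplified]
  obtain p where p: "p \<in> open_arc g"
    using open_arc_nonempty by blast
  then have "p \<in> path_image g" "p \<notin> K"
    using open_arc_eq[OF assms(2)] Kg by auto
  then obtain e where e: "e > 0" "ball p e \<subseteq> - K"
    using \<open>closed K\<close> by (meson ComplI open_Compl openE)
  have "p \<in> frontier (inside ?J)" "p \<in> frontier (outside ?J)"
    using Jordan \<open>p \<in> path_image g\<close> J by auto
  then have "p \<in> closure (inside ?J)" "p \<in> closure (outside ?J)"
    by (auto simp: frontier_def)
  then obtain x y where x: "x \<in> inside ?J" "x \<in> ball p e" and y: "y \<in> outside ?J" "y \<in> ball p e"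
    using e(1) by (metis closure_approachable dist_commute mem_ball)
  have inK: "K \<union> path_image g \<supseteq> ?J"
    using h J by auto
  have xyJ: "x \<notin> ?J" "y \<notin> ?J"
    using x y inside_no_overlap outside_no_overlap by blast+
  show ?thesis
  proof (rule card_components_Compl_less[where x=x and y=y])
    show "U - (K \<union> path_image g) \<noteq> {}" if "open U" "U \<noteq> {}" "U \<subseteq> - K" for U
      using inter_Diff_arc_image_nonempty[OF that(1,2) assms(2)] that(3) by blast
    show "x \<notin> K \<union> path_image g" "y \<notin> K \<union> path_image g"
      using x y e xyJ J by auto
    show "connected_component (- K) x y"
      unfolding connected_component_def using e x y by (intro exI[of _ "ball p e"]) auto
    show "\<not> connected_component (- (K \<union> path_image g)) x y"
    proof
      assume "connected_component (- (K \<union> path_image g)) x y"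
      then have "connected_component (- ?J) x y"
        by (rule connected_component_of_subset) (use inK in auto)
      then show False
        using x y inside_same_component inside_Int_outside by blast
    qed
  qed (use assms in auto)
qed

section \<open>At most two regions along an open arc\<close>

lemma card_le_2I:
  assumes "\<And>x y z. x \<in> A \<Longrightarrow> y \<in> A \<Longrightarrow> z \<in> A \<Longrightarrow> x = y \<or> y = z \<or> x = z"
  shows "finite A \<and> card A \<le> 2"
proof (rule ccontr)
  assume "\<not> ?thesis"
  then obtain B where "B \<subseteq> A" "card B = 3" "finite B"
    using infinite_arbitrarily_large[of A 3] obtain_subset_with_card_n[of 3 A]
    by (metis finite_subset linorder_not_le numeral_2_eq_2 numeral_3_eq_3 Suc_leI)
  then obtain x y z where "B = {x, y, z}" "x \<noteq> y" "y \<noteq> z" "x \<noteq> z"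
    by (metis card_3_iff)
  with \<open>B \<subseteq> A\<close> assms[of x y z] show False by auto
qed

text \<open>A subarc of \<open>g\<close> containing the three contact points is completed by an arc \<open>c\<close> outside \<open>g\<close> to a
  Jordan curve \<open>J\<close>. Two of the three regions have points near \<open>g\<close> on the same side of \<open>J\<close>. The
  rest \<open>T\<close> of the arrangement, including \<open>c\<close>, stays away from the contact points and does not
  separate these two either, and \<open>J \<inter> T = c\<close> is connected, so Janiszewski's theorem applies.\<close>
lemma card_components_touching_open_arc:
  fixes L :: "complex set"
  assumes "compact L" "arc g" and Lg: "L \<inter> path_image g \<subseteq> {pathstart g, pathfinish g}"
  defines "touching \<equiv> {F \<in> components (- (L \<union> path_image g)). closure F \<inter> open_arc g \<noteq> {}}"
  shows "finite touching \<and> card touching \<le> 2"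
proof (rule card_le_2I)
  fix F1 F2 F3
  assume "F1 \<in> touching" "F2 \<in> touching" "F3 \<in> touching"
  then have F: "{F1, F2, F3} \<subseteq> components (- (L \<union> path_image g))"
    and "\<forall>F\<in>{F1,F2,F3}. \<exists>s. 0 < s \<and> s < 1 \<and> g s \<in> closure F"
    by (auto simp: touching_def open_arc_def)
  then obtain s where s: "\<And>F. F \<in> {F1, F2, F3} \<Longrightarrow> 0 < s F \<and> s F < 1 \<and> g (s F) \<in> closure F"
    by (metis (no_types))
  define s0 where "s0 = Min (s ` {F1, F2, F3})"
  define s1 where "s1 = Max (s ` {F1, F2, F3})"
  have s01: "0 < s0" "s1 < 1" and sin: "\<And>F. F \<in> {F1, F2, F3} \<Longrightarrow> s F \<in> {s0..s1}"
    using s[of F1] s[of F2] s[of F3] by (auto simp: s0_def s1_def)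
  have inj: "inj_on g {0..1}" and contg: "continuous_on {0..1} g"
    using assms(2) by (auto simp: arc_def path_def)
  obtain h where h: "homeomorphism {0..1} (path_image g) g h"
    using homeomorphism_arc[OF assms(2)] by blast
  have opn: "openin (top_of_set (frontier (- path_image g))) (g ` A)" if "open A" "A \<subseteq> {0..1}" for A
  proof -
    have "openin (top_of_set {0..1}) A"
      using that by (simp add: open_subset)
    then show ?thesis
      using homeomorphism_imp_open_map[OF h] by (simp add: frontier_arc_image[OF assms(2)])
  qed
  have s0le: "s0 \<le> s1"
    using sin[of F1] by auto
  \<comment> \<open>The accessibility theorem that yields \<open>c\<close> asks for two different
    relatively open parts of the frontier.\<close>
  have "g (s0 / 2) \<notin> g ` {s1<..<1}"
  proof
    assume "g (s0 / 2) \<in> g ` {s1<..<1}"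
    then obtain t where "t \<in> {s1<..<1}" "g (s0 / 2) = g t" by auto
    then have "s0 / 2 = t"
      using s01 s0le by (intro inj_onD[OF inj]) auto
    with \<open>t \<in> {s1<..<1}\<close> s01 s0le show False by auto
  qed
  moreover have "g (s0 / 2) \<in> g ` {0<..<s0}"
    using s01 by auto
  ultimately have ne: "g ` {0<..<s0} \<noteq> g ` {s1<..<1}"
    by metis
  have o1: "open (- path_image g)" "connected (- path_image g)"
    using assms(2) closed_arc_image connected_arc_complement[of g] by auto
  have o2: "openin (top_of_set (frontier (- path_image g))) (g ` {0<..<s0})"
    "openin (top_of_set (frontier (- path_image g))) (g ` {s1<..<1})"
    using s01 s0le by (intro opn; auto)+
  have ne0: "g ` {0<..<s0} \<noteq> {}" "g ` {s1<..<1} \<noteq> {}"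
    using s01 by auto
  \<comment> \<open>The frontier of the complement of \<open>g\<close> is the arc itself, and
    accessible points are dense in it. So some point before all contacts can be joined through the
    complement to some point after all of them.\<close>
  obtain c where c: "arc c" "pathstart c \<in> g ` {0<..<s0}" "pathfinish c \<in> g ` {s1<..<1}"
    "c ` {0<..<1} \<subseteq> - path_image g"
    using dense_accessible_frontier_point_pairs[OF o1 o2 ne0 ne] .
  obtain u where u': "u \<in> {0<..<s0}" "pathstart c = g u"
    using c(2) by (elim imageE)
  obtain v where v': "v \<in> {s1<..<1}" "pathfinish c = g v"
    using c(3) by (elim imageE)
  have u: "0 < u" "u < s0" "pathstart c = g u" and v: "s1 < v" "v < 1" "pathfinish c = g v"
    using u' v' by simp_all
  have cg: "path_image c \<inter> path_image g = {g u, g v}"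
  proof -
    have "path_image c = open_arc c \<union> {g u, g v}"
      using open_arc_eq[OF c(1)] u(3) v(3) pathstart_in_path_image[of c] pathfinish_in_path_image[of c]
      by auto
    moreover have "g u \<in> path_image g" "g v \<in> path_image g"
      unfolding path_image_def using u v s01 s0le by (intro imageI; simp)+
    ultimately show ?thesis
      using c(4) unfolding open_arc_def by blast
  qed
  let ?P = "g ` {u..v}"
  have uv: "u < v" "u \<in> {0..1}" "v \<in> {0..1}"
    using u v s01 s0le by auto
  have Pimg: "path_image (subpath u v g) = ?P"
    using uv by (simp add: path_image_subpath)
  define J where "J = path_image (subpath u v g +++ reversepath c)"
  have JP: "J = ?P \<union> path_image c"
    unfolding J_def using u v Pimg by (simp add: path_image_join)
  have simple: "simple_path (subpath u v g +++ reversepath c)"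
  proof (rule simple_path_join_loop)
    show "arc (subpath u v g)"
      using assms(2) uv by (simp add: arc_subpath_arc)
    have "?P \<subseteq> path_image g"
      using uv by (auto simp: path_image_def)
    then show "path_image (subpath u v g) \<inter> path_image (reversepath c)
        \<subseteq> {pathstart (subpath u v g), pathstart (reversepath c)}"
      using cg Pimg u v by auto
  qed (use c u v in \<open>auto simp: arc_reversepath\<close>)
  \<comment> \<open>\<open>c\<close> avoids \<open>g\<close> between its ends but may cross
    \<open>L\<close>. Such crossings are harmless since \<open>c\<close> belongs to \<open>T\<close>
    too: they lie in \<open>c\<close>, which is all of \<open>J \<inter> T\<close>.\<close>
  define T where "T = L \<union> g ` ({0..u} \<union> {v..1}) \<union> path_image c"
  have gP: "path_image g = g ` {0..u} \<union> ?P \<union> g ` {v..1}"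
    using uv unfolding path_image_def image_Un[symmetric] by (intro arg_cong[of _ _ "image g"]) auto
  have endsP: "pathstart g \<notin> ?P" "pathfinish g \<notin> ?P"
  proof -
    have "?P \<subseteq> open_arc g"
      using u(1) v(2) by (auto simp: open_arc_def)
    then show "pathstart g \<notin> ?P" "pathfinish g \<notin> ?P"
      using open_arc_eq[OF assms(2)] by blast+
  qed
  have Jcompact: "compact J"
    unfolding J_def using simple compact_simple_path_image by blast
  have Tcompact: "compact T"
  proof -
    have "compact (g ` ({0..u} \<union> {v..1}))"
      by (rule compact_continuous_image[OF continuous_on_subset[OF contg]]) (use uv in auto)
    then show ?thesis
      unfolding T_def using assms(1) c(1) compact_arc_image by blast
  qed
  have JT: "J \<inter> T = path_image c"
  proof -
    have PL: "?P \<inter> L \<subseteq> {pathstart g, pathfinish g}"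
      using Lg gP by (metis Int_commute Int_mono Un_upper1 Un_upper2 order_refl order_trans)
    have "?P \<inter> L = {}"
    proof (rule equals0I)
      fix z assume z: "z \<in> ?P \<inter> L"
      then have "z = pathstart g \<or> z = pathfinish g"
        using subsetD[OF PL z] by simp
      with z endsP show False
        by (metis IntD1)
    qed
    moreover have "?P \<inter> g ` ({0..u} \<union> {v..1}) \<subseteq> {g u, g v}"
    proof -
      have "{u..v} \<subseteq> {0..1}" "{0..u} \<union> {v..1} \<subseteq> {0..1}"
        using uv by auto
      then have "?P \<inter> g ` ({0..u} \<union> {v..1}) = g ` ({u..v} \<inter> ({0..u} \<union> {v..1}))"
        by (rule inj_on_image_Int[OF inj, symmetric])
      also have "{u..v} \<inter> ({0..u} \<union> {v..1}) = {u, v}"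
        using uv by auto
      finally show ?thesis
        by simp
    qed
    moreover have "{g u, g v} \<subseteq> path_image c"
      using cg by auto
    moreover have "(P \<union> C) \<inter> (L \<union> R \<union> C) = C" if "P \<inter> L = {}" "P \<inter> R \<subseteq> C" for P R C :: "complex set"
      using that by blast
    ultimately show ?thesis
      unfolding JP T_def by (meson order_trans)
  qed
  let ?Q = "g ` {s0..s1}"
  have QT: "?Q \<inter> T = {}"
  proof -
    have "?Q \<subseteq> ?P"
      using u(2) v(1) by (intro image_mono) auto
    then have "?Q \<inter> T \<subseteq> path_image c"
      using JT JP by blast
    moreover have "?Q \<subseteq> path_image g"
      unfolding path_image_def using s01 by (intro image_mono) auto
    ultimately have "?Q \<inter> T \<subseteq> ?Q \<inter> {g u, g v}"
      using cg by blast
    moreover have "g u \<notin> ?Q"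
      using inj_on_image_mem_iff[OF inj, of u "{s0..s1}"] u(2) uv s01 by auto
    moreover have "g v \<notin> ?Q"
      using inj_on_image_mem_iff[OF inj, of v "{s0..s1}"] v(1) uv s01 by auto
    ultimately show ?thesis
      by auto
  qed
  have "compact ?Q"
    by (rule compact_continuous_image[OF continuous_on_subset[OF contg]]) (use s01 in auto)
  then obtain e where e: "e > 0" "\<And>x y. x \<in> ?Q \<Longrightarrow> y \<in> T \<Longrightarrow> e \<le> dist x y"
    using separate_compact_closed[OF _ compact_imp_closed[OF Tcompact] QT] by blast
  \<comment> \<open>A connected neighbourhood of the stretch of \<open>g\<close> that holds the
    contact points, thin enough to miss \<open>T\<close>; each of the three regions has a point in
    it.\<close>
  define N where "N = (\<Union>q\<in>?Q. ball q e)"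
  have NT: "N \<subseteq> - T"
  proof (rule subsetI)
    fix z assume "z \<in> N"
    then obtain q where "q \<in> ?Q" "dist q z < e"
      unfolding N_def mem_ball[symmetric] by blast
    then show "z \<in> - T"
      using e(2)[of q z] by fastforce
  qed
  have Nconn: "connected N"
  proof -
    have "connected ?Q"
      by (rule connected_continuous_image[OF continuous_on_subset[OF contg]]) (use s01 in auto)
    \<comment> \<open>Adding \<open>?Q\<close> to each ball gives the members of the union a common
      point.\<close>
    have "N = (\<Union>q\<in>?Q. ball q e \<union> ?Q)"
      unfolding N_def using e(1) by force
    also have "connected \<dots>"
    proof (rule connected_Union)
      fix B assume "B \<in> (\<lambda>q. ball q e \<union> ?Q) ` ?Q"
      then obtain q where q: "q \<in> ?Q" "B = ball q e \<union> ?Q" by blast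
      then have "q \<in> ball q e \<inter> ?Q" using e(1) by simp
      then show "connected B"
        unfolding q(2) by (intro connected_Un connected_ball \<open>connected ?Q\<close>) blast
    qed (use s0le in auto)
    finally show ?thesis .
  qed
  have "\<exists>x. x \<in> F \<and> x \<in> N" if "F \<in> {F1, F2, F3}" for F
  proof -
    have "g (s F) \<in> closure F" "g (s F) \<in> ?Q"
      using s[OF that] sin[OF that] by auto
    then show ?thesis
      unfolding N_def using e(1) by (metis UN_I closure_approachable dist_commute mem_ball)
  qed
  then obtain x where x: "\<And>F. F \<in> {F1, F2, F3} \<Longrightarrow> x F \<in> F \<and> x F \<in> N"
    by metis
  note Jordan = Jordan_inside_outside[OF simple, folded J_def]
  have xJ: "x F \<in> inside J \<union> outside J" if "F \<in> {F1, F2, F3}" for F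
  proof -
    have "x F \<notin> path_image g"
      using x[OF that] F that in_components_subset by blast
    moreover have "x F \<notin> path_image c"
      using x[OF that] NT by (auto simp: T_def)
    ultimately have "x F \<notin> J"
      using JP gP by auto
    then show ?thesis
      using Jordan u v by auto
  qed
  have same: "F = F'" if FF': "F \<in> {F1, F2, F3}" "F' \<in> {F1, F2, F3}"
      and side: "x F \<in> S" "x F' \<in> S" "S \<in> {inside J, outside J}" for F F' S
  proof -
    have "connected_component (- (J \<union> T)) (x F) (x F')"
    proof (rule Janiszewski)
      show "connected_component (- J) (x F) (x F')"
        unfolding connected_component_def
      proof (intro exI[of _ S] conjI)
        show "connected S"
          using Jordan u v side(3) by auto
        show "S \<subseteq> - J"
          using inside_Un_outside[of J] side(3) by blast
      qed (use side in auto)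
      show "connected_component (- T) (x F) (x F')"
        unfolding connected_component_def using Nconn NT x FF' by (intro exI[of _ N]) auto
    qed (use Jcompact Tcompact compact_imp_closed JT c(1) connected_arc_image in auto)
    \<comment> \<open>\<open>J \<union> T\<close> contains the whole arrangement and also
      \<open>c\<close>, so being connected off it is the stronger property.\<close>
    then have "connected_component (- (L \<union> path_image g)) (x F) (x F')"
      by (rule connected_component_of_subset) (auto simp: JP T_def gP)
    then obtain W where "connected W" "W \<subseteq> - (L \<union> path_image g)" "x F \<in> W" "x F' \<in> W"
      unfolding connected_component_def by blast
    then show ?thesis
      using x[OF FF'(1)] x[OF FF'(2)] F FF'
      by (intro joinable_components_eq[of W "- (L \<union> path_image g)"]) blast
  qed
  show "F1 = F2 \<or> F2 = F3 \<or> F1 = F3"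
  proof -
    obtain S1 S2 S3 where "x F1 \<in> S1" "x F2 \<in> S2" "x F3 \<in> S3"
      and S: "{S1, S2, S3} \<subseteq> {inside J, outside J}"
      using xJ[of F1] xJ[of F2] xJ[of F3] by blast
    then show ?thesis
      using same[of F1 F2 S1] same[of F2 F3 S2] same[of F1 F3 S1] by auto
  qed
qed

section \<open>Edges of plane drawings\<close>

text \<open>Vertices and edges are free parameters so that any subset of the edges, with just the
  vertices it covers, is again an instance. This turns the edge bound into a Hall condition.\<close>

locale arc_drawing =
  fixes V :: "'a set" and E :: "'a set set"
    and pos :: "'a \<Rightarrow> complex" and \<gamma> :: "'a set \<Rightarrow> real \<Rightarrow> complex"
  assumes finite_V: "finite V"
    and edge_subset: "e \<in> E \<Longrightarrow> e \<subseteq> V"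
    and card_edge: "e \<in> E \<Longrightarrow> card e = 2"
    and arc_edge: "e \<in> E \<Longrightarrow> arc (\<gamma> e)"
    and ends_edge: "e \<in> E \<Longrightarrow> {pathstart (\<gamma> e), pathfinish (\<gamma> e)} = pos ` e"
    and edge_vertices: "e \<in> E \<Longrightarrow> path_image (\<gamma> e) \<inter> pos ` V = pos ` e"
    and edge_edge: "e \<in> E \<Longrightarrow> e' \<in> E \<Longrightarrow> e \<noteq> e' \<Longrightarrow>
      path_image (\<gamma> e) \<inter> path_image (\<gamma> e') \<subseteq> pos ` (e \<inter> e')"
begin

text \<open>All vertex points are present whatever \<open>D\<close> is, so a further edge always
  meets \<open>drawn D\<close> in exactly its two ends.\<close>

definition drawn :: "'a set set \<Rightarrow> complex set" where
  "drawn D = pos ` V \<union> (\<Union>e\<in>D. path_image (\<gamma> e))"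

lemma finite_E: "finite E"
  by (rule finite_subset[of _ "Pow V"]) (use edge_subset finite_V in auto)

lemma compact_drawn: "D \<subseteq> E \<Longrightarrow> compact (drawn D)"
  unfolding drawn_def
  using finite_V finite_subset[OF _ finite_E] arc_edge
  by (intro compact_Un compact_UN finite_imp_compact finite_imageI compact_arc_image) auto

lemma closed_drawn: "D \<subseteq> E \<Longrightarrow> closed (drawn D)"
  by (simp add: compact_drawn compact_imp_closed)

lemma drawn_Int_edge:
  assumes "D \<subseteq> E" "e \<in> E" "e \<notin> D"
  shows "drawn D \<inter> path_image (\<gamma> e) = {pathstart (\<gamma> e), pathfinish (\<gamma> e)}"
proof -
  have "path_image (\<gamma> e') \<inter> path_image (\<gamma> e) \<subseteq> pos ` e" if "e' \<in> D" for e'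
    using edge_edge[of e' e] that assms by blast
  then show ?thesis
    unfolding drawn_def ends_edge[OF assms(2)] using edge_vertices[OF assms(2)] by blast
qed

lemma drawn_insert: "drawn (insert e D) = drawn D \<union> path_image (\<gamma> e)"
  by (auto simp: drawn_def)

lemma open_arc_Int_pos:
  assumes "e \<in> E"
  shows "open_arc (\<gamma> e) \<inter> pos ` V = {}"
  unfolding open_arc_eq[OF arc_edge[OF assms]] ends_edge[OF assms]
  using edge_vertices[OF assms] by blast

lemma open_arc_Int_edge:
  assumes "e \<in> E" "e' \<in> E" "e \<noteq> e'"
  shows "open_arc (\<gamma> e) \<inter> path_image (\<gamma> e') = {}"
proof -
  have "open_arc (\<gamma> e) \<inter> path_image (\<gamma> e') \<subseteq> pos ` (e \<inter> e')"
    using edge_edge[OF assms] open_arc_subset by blast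
  also have "\<dots> \<subseteq> pos ` V"
    using edge_subset assms by blast
  finally show ?thesis
    using open_arc_Int_pos[OF assms(1)] by blast
qed

text \<open>Two different edges share at most one vertex, since there are no parallel edges, so
  their images meet in a connected set. By Janiszewski's theorem their union does not separate the
  plane, and deleting finitely many points from a connected open set of the plane keeps it
  connected.\<close>

lemma connected_Compl_two_edges:
  assumes "e \<in> E" "e' \<in> E"
  shows "connected (- (pos ` V \<union> path_image (\<gamma> e) \<union> path_image (\<gamma> e')))"
proof -
  have arc_compl: "connected (- path_image (\<gamma> d))" if "d \<in> E" for d
    using arc_edge[OF that] by (intro connected_arc_complement) auto
  have "connected (path_image (\<gamma> e) \<inter> path_image (\<gamma> e'))"
  proof (cases "e = e'")
    case True
    then show ?thesis
      using arc_edge[OF assms(1)] connected_arc_image by simp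
  next
    case False
    then have "card (e \<inter> e') \<noteq> 2"
      using card_edge assms finite_V edge_subset
      by (metis Int_lower1 Int_lower2 card_subset_eq finite_subset)
    moreover have "finite e"
      using assms(1) edge_subset finite_V finite_subset by blast
    ultimately have "card (e \<inter> e') \<le> 1"
      using card_mono[of e "e \<inter> e'"] card_edge[OF assms(1)] by simp
    then obtain x where "e \<inter> e' \<subseteq> {x}"
      using \<open>finite e\<close> by (metis card_le_Suc0_iff_eq finite_Int One_nat_def empty_subsetI insertI1 subsetI singletonI)
    then have "path_image (\<gamma> e) \<inter> path_image (\<gamma> e') \<subseteq> {pos x}"
      using edge_edge[OF assms False] by blast
    then show ?thesis
      by (metis connected_empty connected_sing subset_singletonD)
  qed
  then have "connected (- (path_image (\<gamma> e) \<union> path_image (\<gamma> e')))"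
    using arc_edge assms compact_arc_image closed_arc_image arc_compl
    by (intro Janiszewski_connected) auto
  moreover have "open (- (path_image (\<gamma> e) \<union> path_image (\<gamma> e')))"
    using arc_edge assms closed_arc_image by blast
  ultimately have "connected (- (path_image (\<gamma> e) \<union> path_image (\<gamma> e')) - pos ` V)"
    using finite_V by (intro connected_open_delete_finite) auto
  moreover have "- (path_image (\<gamma> e) \<union> path_image (\<gamma> e')) - pos ` V
      = - (pos ` V \<union> path_image (\<gamma> e) \<union> path_image (\<gamma> e'))"
    by blast
  ultimately show ?thesis
    by simp
qed

section \<open>Faces and the edges on their boundary\<close>

definition faces :: "complex set set" where
  "faces = components (- drawn E)"

text \<open>The ends of the edge do not count: arbitrarily many faces can meet at a vertex, and the
  bound of two faces per edge would fail.\<close>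

definition touches :: "complex set \<Rightarrow> 'a set \<Rightarrow> bool" where
  "touches F e \<longleftrightarrow> closure F \<inter> open_arc (\<gamma> e) \<noteq> {}"

lemma faces_touching_edge:
  assumes "e \<in> E"
  shows "finite {F \<in> faces. touches F e}" "card {F \<in> faces. touches F e} \<le> 2"
proof -
  have "drawn E = drawn (E - {e}) \<union> path_image (\<gamma> e)"
    using drawn_insert[of e "E - {e}"] assms by (simp add: insert_absorb)
  then show "finite {F \<in> faces. touches F e}" "card {F \<in> faces. touches F e} \<le> 2"
    using card_components_touching_open_arc[of "drawn (E - {e})" "\<gamma> e"]
      compact_drawn arc_edge[OF assms] drawn_Int_edge[of "E - {e}" e] assms
    by (simp_all add: faces_def touches_def)
qed

text \<open>If the boundary of a face \<open>F\<close> were covered by the vertices and two edges, it would not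
  separate the plane, so \<open>F\<close> would be its complement and there would be no third edge.\<close>
lemma face_touches_three_edges:
  assumes "3 \<le> card E" "F \<in> faces"
  shows "3 \<le> card {e \<in> E. touches F e}"
proof (rule ccontr)
  assume "\<not> ?thesis"
  then have le2: "card {e \<in> E. touches F e} \<le> 2" by simp
  \<comment> \<open>As there are at least three edges, the touched ones can be padded to exactly
    two.\<close>
  have "\<exists>D. {e \<in> E. touches F e} \<subseteq> D \<and> D \<subseteq> E \<and> card D = 2"
    using exists_subset_between[OF le2 _ _ finite_E] assms(1) by auto
  then obtain e1 e2 where e: "e1 \<in> E" "e2 \<in> E" "{e \<in> E. touches F e} \<subseteq> {e1, e2}"
    by (auto simp: card_2_iff)
  define L where "L = pos ` V \<union> path_image (\<gamma> e1) \<union> path_image (\<gamma> e2)"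
  have L: "connected (- L)" "L \<subseteq> drawn E"
    using connected_Compl_two_edges[OF e(1,2)] e by (auto simp: L_def drawn_def)
  have F: "open F" "F \<noteq> {}" "F \<subseteq> - drawn E"
    using assms(2) closed_drawn[of E] open_components in_components_nonempty in_components_subset
    unfolding faces_def by blast+
  have "closure F \<inter> drawn E \<subseteq> L"
  proof
    fix z assume z: "z \<in> closure F \<inter> drawn E"
    show "z \<in> L"
    proof (cases "z \<in> pos ` V")
      case False
      then obtain d where d: "d \<in> E" "z \<in> path_image (\<gamma> d)"
        using z by (auto simp: drawn_def)
      then have "z \<in> open_arc (\<gamma> d)"
        unfolding open_arc_eq[OF arc_edge[OF d(1)]] ends_edge[OF d(1)]
        using False edge_subset[OF d(1)] by blast
      then have "touches F d"
        using z by (auto simp: touches_def)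
      then show ?thesis
        using d e(3) by (auto simp: L_def)
    qed (simp add: L_def)
  qed
  moreover have "closure F \<inter> - drawn E \<subseteq> F"
  proof -
    obtain T where "closed T" "F = T \<inter> - drawn E"
      using closedin_component assms(2) unfolding faces_def by (metis closedin_closed Int_commute)
    then show ?thesis
      by (metis closure_minimal inf_le1 inf_mono order_refl)
  qed
  \<comment> \<open>Off \<open>L\<close> the closure of \<open>F\<close> adds nothing to
    \<open>F\<close>. So \<open>F\<close> is open and closed in the connected set \<open>- L\<close>
    and must be all of it.\<close>
  ultimately have "F = - L \<inter> closure F"
    using F(3) L(2) closure_subset[of F] by blast
  then have "closedin (top_of_set (- L)) F"
    by (metis closedin_closed closed_closure)
  moreover have "openin (top_of_set (- L)) F"
    using F(1,3) L(2) by (intro open_subset) auto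
  ultimately have "F = - L"
    using L(1) F(2) by (auto simp: connected_clopen)
  then have drawn: "drawn E \<subseteq> L"
    using F(3) by blast
  have "card {e1, e2} \<le> 2"
    by (simp add: card_insert_if)
  then have "\<not> E \<subseteq> {e1, e2}"
    using assms(1) card_mono[of "{e1, e2}" E] by auto
  then obtain e3 where e3: "e3 \<in> E" "e3 \<noteq> e1" "e3 \<noteq> e2"
    by blast
  then have "open_arc (\<gamma> e3) \<inter> L = {}"
    using open_arc_Int_pos[OF e3(1)] open_arc_Int_edge[OF e3(1)] e(1,2) by (auto simp: L_def)
  moreover have "open_arc (\<gamma> e3) \<subseteq> drawn E"
    using e3(1) open_arc_subset by (auto simp: drawn_def)
  ultimately show False
    using drawn open_arc_nonempty by blast
qed

text \<open>Every face touches some edge, and every edge is touched by finitely many faces.\<close>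

lemma finite_faces:
  assumes "3 \<le> card E"
  shows "finite faces"
proof -
  have "faces \<subseteq> (\<Union>e\<in>E. {F \<in> faces. touches F e})"
  proof
    fix F assume "F \<in> faces"
    moreover from this have "{e \<in> E. touches F e} \<noteq> {}"
      using face_touches_three_edges[OF assms, of F] by (metis card.empty not_numeral_le_zero)
    ultimately show "F \<in> (\<Union>e\<in>E. {F \<in> faces. touches F e})"
      by blast
  qed
  then show ?thesis
    using finite_E faces_touching_edge(1) by (meson finite_UN_I finite_subset)
qed

lemma three_faces_le_two_edges:
  assumes "3 \<le> card E"
  shows "3 * card faces \<le> 2 * card E"
proof -
  have "3 * card faces \<le> (\<Sum>F\<in>faces. card {e \<in> E. touches F e})"
    using sum_mono[of faces "\<lambda>_. 3" "\<lambda>F. card {e \<in> E. touches F e}"]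
      face_touches_three_edges[OF assms] by simp
  also have "\<dots> = (\<Sum>e\<in>E. card {F \<in> faces. touches F e})"
    using sum.swap_restrict[OF finite_faces[OF assms] finite_E, of "\<lambda>_ _. 1::nat" touches] by simp
  also have "\<dots> \<le> 2 * card E"
    using sum_mono[of E "\<lambda>e. card {F \<in> faces. touches F e}" "\<lambda>_. 2"] faces_touching_edge(2)
    by simp
  finally show ?thesis .
qed

section \<open>Euler's inequality and the bound on the number of edges\<close>

lemma open_Diff_drawn:
  assumes "D \<subseteq> E" "open U" "U \<noteq> {}"
  shows "U - drawn D \<noteq> {}"
proof -
  have "U - (\<Union>e\<in>D. path_image (\<gamma> e)) \<noteq> {} \<and> open (U - (\<Union>e\<in>D. path_image (\<gamma> e)))"
    using finite_subset[OF assms(1) finite_E] assms(1)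
  proof (induction D rule: finite_induct)
    case (insert e D)
    let ?W = "U - (\<Union>e\<in>D. path_image (\<gamma> e))"
    have W: "?W \<noteq> {}" "open ?W"
      using insert.IH insert.prems by auto
    have e: "arc (\<gamma> e)"
      using insert.prems arc_edge by simp
    have "U - (\<Union>e\<in>insert e D. path_image (\<gamma> e)) = ?W - path_image (\<gamma> e)"
      by auto
    then show ?case
      using inter_Diff_arc_image_nonempty[OF W(2,1) e] open_Diff[OF W(2) closed_arc_image[OF e]] by simp
  qed (use assms in auto)
  \<comment> \<open>A nonempty open set of the plane is infinite, so the finitely many vertex points
    cannot exhaust it.\<close>
  then have "infinite (U - (\<Union>e\<in>D. path_image (\<gamma> e)))"
    using finite_imp_not_open by blast
  then have "infinite (U - (\<Union>e\<in>D. path_image (\<gamma> e)) - pos ` V)"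
    using finite_V by simp
  moreover have "U - (\<Union>e\<in>D. path_image (\<gamma> e)) - pos ` V = U - drawn D"
    unfolding drawn_def by blast
  ultimately show ?thesis
    by (metis finite.emptyI)
qed

text \<open>The number of parts of the vertex set joined by the drawn edges drops whenever an added edge
  does not increase the number of regions.\<close>
lemma euler_inequality:
  assumes fin: "finite faces"
  shows "card E \<le> card faces + card V"
proof -
  define \<kappa> where "\<kappa> D = card ((\<lambda>v. path_component_set (drawn D) (pos v)) ` V)" for D
  \<comment> \<open>Deleting edges only merges regions, so finiteness passes down from the full
    drawing. It is essential because \<open>card\<close> of an infinite set is 0.\<close>
  have finD: "finite (components (- drawn D))" if "D \<subseteq> E" for D
  proof (rule finite_components_Compl_subset)
    show "drawn D \<subseteq> drawn E" using that by (auto simp: drawn_def)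
  qed (use fin that closed_drawn open_Diff_drawn in \<open>auto simp: faces_def\<close>)
  \<comment> \<open>A new edge raises \<open>card D\<close> by one. If it closes a Jordan curve, the
    regions increase and \<open>\<kappa>\<close> does not; if it joins two parts,
    \<open>\<kappa>\<close> drops and the regions do not decrease.\<close>
  have "card D + \<kappa> D \<le> card (components (- drawn D)) + card V" if "finite D" "D \<subseteq> E" for D
    using that
  proof (induction D rule: finite_induct)
    case empty
    show ?case
      by (simp add: \<kappa>_def card_image_le finite_V trans_le_add2)
  next
    case (insert e D)
    then have D: "D \<subseteq> E" "e \<in> E" "e \<notin> D" by auto
    let ?C = "\<lambda>D v. path_component_set (drawn D) (pos v)"
    have sub: "drawn D \<subseteq> drawn (insert e D)" by (auto simp: drawn_def)
    have coarse: "?C (insert e D) u = ?C (insert e D) v" if "u \<in> V" "v \<in> V" "?C D u = ?C D v" for u v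
    proof -
      have "path_component (drawn D) (pos v) (pos v)"
        using that(2) by (simp add: path_component_refl drawn_def)
      then have "path_component (drawn D) (pos u) (pos v)"
        using that(3) by blast
      then have "path_component (drawn (insert e D)) (pos u) (pos v)"
        using sub path_component_of_subset by blast
      then show ?thesis
        by (simp add: path_component_eq)
    qed
    have finC: "finite (?C D ` V)"
      using finite_V by simp
    have posE: "{pathstart (\<gamma> e), pathfinish (\<gamma> e)} \<subseteq> pos ` V"
      using ends_edge[OF D(2)] edge_subset[OF D(2)] by blast
    have IH: "card D + \<kappa> D \<le> card (components (- drawn D)) + card V"
      using insert.IH D by simp
    have card: "card (insert e D) = card D + 1"
      using insert.hyps by simp
    show ?case
    proof (cases "path_component (drawn D) (pathfinish (\<gamma> e)) (pathstart (\<gamma> e))")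
      case True
      have "card (components (- drawn D)) < card (components (- (drawn D \<union> path_image (\<gamma> e))))"
        by (rule card_components_Compl_Un_arc[OF closed_drawn[OF D(1)] arc_edge[OF D(2)]
              drawn_Int_edge[OF D] True])
          (use finD[OF insert.prems] in \<open>simp add: drawn_insert\<close>)
      moreover have "\<kappa> (insert e D) \<le> \<kappa> D"
        unfolding \<kappa>_def by (rule card_image_coarser_le[OF finC coarse])
      ultimately show ?thesis
        using IH card by (simp add: drawn_insert)
    next
      case False
      obtain u v where uv: "u \<in> V" "v \<in> V" "pos u = pathfinish (\<gamma> e)" "pos v = pathstart (\<gamma> e)"
        using posE by auto
      have "path_component (drawn (insert e D)) (pos v) (pos u)"
        using arc_imp_path[OF arc_edge[OF D(2)]] uv
        by (auto simp: path_component_def drawn_insert intro!: exI[of _ "\<gamma> e"])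
      then have eq: "?C (insert e D) u = ?C (insert e D) v"
        by (simp add: path_component_eq)
      have neq: "?C D u \<noteq> ?C D v"
      proof
      assume "?C D u = ?C D v"
      moreover have "pos v \<in> ?C D v"
        using uv(2) by (simp add: path_component_refl drawn_def)
      ultimately have "path_component (drawn D) (pos u) (pos v)"
        by blast
      with False uv(3,4) show False by simp
    qed
      have "\<kappa> (insert e D) < \<kappa> D"
        unfolding \<kappa>_def by (rule card_image_coarser_less[OF finC coarse uv(1,2) neq eq])
      moreover have "card (components (- drawn D)) \<le> card (components (- drawn (insert e D)))"
      proof (rule card_components_Compl_le[OF sub closed_drawn[OF D(1)]])
        show "U - drawn (insert e D) \<noteq> {}" if "open U" "U \<noteq> {}" for U
          using open_Diff_drawn[OF insert.prems that] .
      qed (rule finD[OF insert.prems])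
      ultimately show ?thesis
        using IH card by simp
    qed
  qed
  \<comment> \<open>Here \<open>\<kappa> E\<close> is dropped as nonnegative, which costs only an
    additive term against Euler's formula.\<close>
  from this[OF finite_E order_refl] show ?thesis
    by (simp add: faces_def)
qed

lemma card_edges_le: "card E \<le> 3 * card V"
proof (cases "3 \<le> card E")
  case True
  then show ?thesis
    using three_faces_le_two_edges euler_inequality[OF finite_faces] by fastforce
next
  case False
  show ?thesis
  proof (cases "E = {}")
    case False
    then have "V \<noteq> {}"
      using edge_subset card_edge by fastforce
    then have "card V \<ge> 1"
      using finite_V by (simp add: Suc_leI card_gt_0_iff)
    with \<open>\<not> 3 \<le> card E\<close> show ?thesis by simp
  qed simp
qed

text \<open>This is Hall's condition for letting each edge choose one of its ends, with capacity 3
  at every vertex.\<close>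

lemma card_subset_edges_le:
  assumes "D \<subseteq> E"
  shows "card D \<le> 3 * card (\<Union>D)"
proof -
  have sub: "\<Union>D \<subseteq> V"
    using assms edge_subset by blast
  interpret D: arc_drawing "\<Union>D" D pos \<gamma>
  proof
    show "finite (\<Union>D)"
      using finite_V sub by (rule rev_finite_subset)
    show "path_image (\<gamma> e) \<inter> pos ` \<Union>D = pos ` e" if "e \<in> D" for e
      using edge_vertices[of e] that assms sub by blast
  qed (use assms card_edge arc_edge ends_edge edge_edge in \<open>auto simp: subset_iff\<close>)
  show ?thesis
    by (rule D.card_edges_le)
qed

end

section \<open>Orientations of bounded out-degree\<close>

text \<open>As in Rado's proof, a set \<open>A d\<close> with two elements \<open>x\<close> and \<open>y\<close> can always be shrunk: by
  submodularity, removing \<open>x\<close> and removing \<open>y\<close> cannot both violate the condition.\<close>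
lemma capacitated_Hall:
  fixes A :: "'e \<Rightarrow> 'v set" and k :: nat
  assumes "finite E" "\<And>e. e \<in> E \<Longrightarrow> finite (A e)"
    and Hall: "\<And>D. D \<subseteq> E \<Longrightarrow> card D \<le> k * card (\<Union>(A ` D))"
  shows "\<exists>f. (\<forall>e\<in>E. f e \<in> A e) \<and> (\<forall>v. card {e \<in> E. f e = v} \<le> k)"
  using assms(2,3)
proof (induction "\<Sum>e\<in>E. card (A e)" arbitrary: A rule: less_induct)
  case less
  note fin = less.prems(1) and Hall = less.prems(2)
  show ?case
  proof (cases "\<exists>e\<in>E. 2 \<le> card (A e)")
    case False
    define f where "f e = (SOME v. v \<in> A e)" for e
    have f: "A e = {f e}" if "e \<in> E" for e
    proof -
      have "card (A e) \<noteq> 0"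
        using Hall[of "{e}"] that by (cases "card (A e)") auto
      then have "card (A e) = 1"
        using False that by force
      then show ?thesis
        unfolding f_def by (metis card_1_singletonE singletonD someI_ex singletonI)
    qed
    \<comment> \<open>All sets are singletons now, so \<open>f\<close> is forced and the capacity
      bound is Hall's condition for the fibre of \<open>v\<close>.\<close>
    have "card {e \<in> E. f e = v} \<le> k" for v
    proof -
      have "\<Union>(A ` {e \<in> E. f e = v}) \<subseteq> {v}"
        using f by auto
      then have "card (\<Union>(A ` {e \<in> E. f e = v})) \<le> 1"
        using card_mono[of "{v}"] by simp
      then have "k * card (\<Union>(A ` {e \<in> E. f e = v})) \<le> k"
        using mult_le_mono2[of _ 1 k] by simp
      moreover have "{e \<in> E. f e = v} \<subseteq> E"
        by blast
      ultimately show ?thesis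
        using Hall[of "{e \<in> E. f e = v}"] by linarith
    qed
    then show ?thesis
      using f by blast
  next
    case True
    then obtain d where d: "d \<in> E" "2 \<le> card (A d)" by blast
    then obtain x y where xy: "x \<in> A d" "y \<in> A d" "x \<noteq> y"
      by (metis card_2_iff' obtain_subset_with_card_n subsetD)
    let ?A = "\<lambda>x. A(d := A d - {x})"
    have rec: ?thesis if "z \<in> A d" and H: "\<And>D. D \<subseteq> E \<Longrightarrow> card D \<le> k * card (\<Union>(?A z ` D))" for z
    proof -
      have "(\<Sum>e\<in>E. card (?A z e)) < (\<Sum>e\<in>E. card (A e))"
      proof (rule sum_strict_mono_ex1[OF assms(1)])
        show "\<forall>e\<in>E. card (?A z e) \<le> card (A e)"
          using fin by (auto intro: card_mono)
        show "\<exists>e\<in>E. card (?A z e) < card (A e)"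
          using d(1) that(1) fin[OF d(1)] by (intro bexI[of _ d]) (simp_all only: fun_upd_same card_Diff1_less)
      qed
      moreover have "finite (?A z e)" if "e \<in> E" for e
        using fin[OF that] by auto
      ultimately obtain f where f: "\<forall>e\<in>E. f e \<in> ?A z e" "\<forall>v. card {e \<in> E. f e = v} \<le> k"
        using less.hyps[of "?A z"] H by blast
      have "?A z e \<subseteq> A e" for e
        by auto
      with f show ?thesis
        by blast
    qed
    show ?thesis
    proof (rule ccontr)
      assume contra: "\<not> ?thesis"
      \<comment> \<open>Shrinking \<open>A d\<close> affects only families containing
        \<open>d\<close>, so a violating family contains \<open>d\<close>. Leaving \<open>d\<close>
        out turns the strict inequality into a weak one.\<close>
      have tight: "\<exists>D \<subseteq> E - {d}. k * card (\<Union>(A ` D) \<union> (A d - {z})) \<le> card D" if z: "z \<in> A d" for z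
      proof -
        obtain D where D: "D \<subseteq> E" "k * card (\<Union>(?A z ` D)) < card D"
          using rec[OF z] contra by (meson linorder_not_le)
        have eq: "\<Union>(?A z ` (D - {d})) = \<Union>(A ` (D - {d}))"
          by auto
        have "d \<in> D"
        proof (rule ccontr)
          assume "d \<notin> D"
          then have "D - {d} = D" by simp
          with eq D Hall[OF D(1)] show False by simp
        qed
        then have UD: "\<Union>(?A z ` D) = \<Union>(A ` (D - {d})) \<union> (A d - {z})"
          using eq by auto
        have "card D = card (D - {d}) + 1"
          using \<open>d \<in> D\<close> D(1) assms(1) by (metis Suc_eq_plus1 card.remove finite_subset)
        moreover have "k * card (\<Union>(A ` (D - {d})) \<union> (A d - {z})) < card D"
          using D(2) by (simp only: UD)
        ultimately have "k * card (\<Union>(A ` (D - {d})) \<union> (A d - {z})) \<le> card (D - {d})"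
          by (simp only: less_Suc_eq_le Suc_eq_plus1[symmetric])
        moreover have "D - {d} \<subseteq> E - {d}"
          using D(1) by blast
        ultimately show ?thesis
          by (intro exI[of _ "D - {d}"] conjI)
      qed
      obtain D1 D2 where
        D1: "D1 \<subseteq> E - {d}" "k * card (\<Union>(A ` D1) \<union> (A d - {x})) \<le> card D1" and
        D2: "D2 \<subseteq> E - {d}" "k * card (\<Union>(A ` D2) \<union> (A d - {y})) \<le> card D2"
        using tight[OF xy(1)] tight[OF xy(2)] by blast
      let ?X = "\<Union>(A ` D1) \<union> (A d - {x})" and ?Y = "\<Union>(A ` D2) \<union> (A d - {y})"
      have finD: "finite D1" "finite D2"
        using D1(1) D2(1) assms(1) by (meson finite_Diff finite_subset)+
      have finXY: "finite ?X" "finite ?Y"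
        using finD D1(1) D2(1) d(1) fin by auto
      \<comment> \<open>As \<open>x\<close> and \<open>y\<close> differ, \<open>?X\<close> and
        \<open>?Y\<close> together recover all of \<open>A d\<close>. Hence Hall's condition applies
        to the union with \<open>d\<close> included, and this additional element gives the
        contradiction.\<close>
      have XY: "?X \<union> ?Y = \<Union>(A ` insert d (D1 \<union> D2))"
        using xy by auto
      have "card (insert d (D1 \<union> D2)) \<le> k * card (?X \<union> ?Y)"
        unfolding XY using D1(1) D2(1) d(1) by (intro Hall) auto
      then have un: "card (D1 \<union> D2) + 1 \<le> k * card (?X \<union> ?Y)"
        using finD D1(1) D2(1) by (subst (asm) card_insert_disjoint) auto
      have "card (D1 \<inter> D2) \<le> k * card (\<Union>(A ` (D1 \<inter> D2)))"
        using Hall[of "D1 \<inter> D2"] D1(1) by blast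
      also have "\<dots> \<le> k * card (?X \<inter> ?Y)"
        using finXY by (intro mult_le_mono2 card_mono) auto
      finally have "card (D1 \<union> D2) + card (D1 \<inter> D2) + 1 \<le> k * (card (?X \<union> ?Y) + card (?X \<inter> ?Y))"
        using un by (simp add: distrib_left)
      also have "\<dots> = k * (card ?X + card ?Y)"
        using card_Un_Int[OF finXY] by simp
      also have "\<dots> \<le> card D1 + card D2"
        using D1(2) D2(2) by (simp add: distrib_left)
      finally show False
        using card_Un_Int[OF finD] by simp
    qed
  qed
qed

section \<open>Stars of unit bars\<close>

lemma bars_see_commute: "bars_see \<B> A B \<longleftrightarrow> bars_see \<B> B A"
  unfolding bars_see_def by (simp only: disj_commute)

text \<open>The \<open>h\<close>-th star occupies the strip around \<open>4 * h\<close>: slot 3 is its centre, slots 0 and 1 are two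
  leaves above it, overhanging on either side, and slot 2 is a leaf below it that does not overhang.\<close>
definition star_shift :: "nat \<Rightarrow> real" where
  "star_shift s = (if s = 0 then - 3/5 else if s = 1 then 3/5 else 0)"

definition star_level :: "nat \<Rightarrow> real" where
  "star_level s = (if s = 3 then 0 else if s = 2 then - 1 else 1)"

text \<open>Relative to \<open>4 * h\<close> the centre lies over [0, 1] and the upper leaves over
  [-3/5, 2/5] and [3/5, 8/5]: disjoint, yet each overlaps the centre in length 2/5.\<close>

definition star_bar :: "nat \<times> nat \<Rightarrow> (real \<times> real) set" where
  "star_bar p = {4 * real (fst p) + star_shift (snd p)..4 * real (fst p) + star_shift (snd p) + 1}
     \<times> {star_level (snd p)}"

lemma unit_bar_star_bar: "unit_bar (star_bar p)"
  by (auto simp: unit_bar_def star_bar_def)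

text \<open>Star \<open>h\<close> stays within the strip from \<open>4 * h - 1\<close> to
  \<open>4 * h + 2\<close>; these strips have width 3 and are 4 apart, so no vertical line meets two
  stars.\<close>

lemma star_bar_overlap:
  assumes "x \<in> {4 * real h + star_shift s..4 * real h + star_shift s + 1}"
    and "x \<in> {4 * real h' + star_shift s'..4 * real h' + star_shift s' + 1}"
  shows "h = h'"
proof -
  have b: "- 1 \<le> star_shift t \<and> star_shift t \<le> 1" for t
    by (simp add: star_shift_def)
  have "4 * real h < 4 * real h' + 4" "4 * real h' < 4 * real h + 4"
    using assms b[of s] b[of s'] by auto
  then show ?thesis by linarith
qed

lemma star_bar_disjoint:
  assumes "snd p \<le> 3" "snd q \<le> 3" "p \<noteq> q"
  shows "star_bar p \<inter> star_bar q = {}"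
proof (rule equals0I)
  fix z assume "z \<in> star_bar p \<inter> star_bar q"
  then have x: "fst z \<in> {4 * real (fst p) + star_shift (snd p)..4 * real (fst p) + star_shift (snd p) + 1}"
      "fst z \<in> {4 * real (fst q) + star_shift (snd q)..4 * real (fst q) + star_shift (snd q) + 1}"
    and y: "star_level (snd p) = star_level (snd q)"
    by (auto simp: star_bar_def)
  have h: "fst p = fst q"
    using star_bar_overlap[OF x] .
  then have ne: "snd p \<noteq> snd q"
    using assms(3) by (simp add: prod_eq_iff)
  have "snd p \<in> {0, 1}" "snd q \<in> {0, 1}"
    using y ne assms(1,2) by (auto simp: star_level_def split: if_splits)
  with ne x h show False
    by (auto simp: star_shift_def)
qed

text \<open>Centre and leaf lie on neighbouring levels among -1, 0 and 1, so no bar of any star has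
  its height strictly between them. The rectangle can be taken over their whole horizontal
  overlap.\<close>

lemma center_sees_leaf:
  assumes "s < 3" "\<B> \<subseteq> range star_bar"
  shows "bars_see \<B> (star_bar (h, 3)) (star_bar (h, s))"
proof -
  have clear: "\<forall>C\<in>\<B>. interior ({l..r} \<times> {b..t}) \<inter> C = {}"
    if "(b, t) = (0, 1) \<or> (b, t) = (- 1, 0)" for l r b t :: real
  proof
    fix C assume "C \<in> \<B>"
    then obtain p where "C = star_bar p"
      using assms(2) by blast
    moreover have "star_level (snd p) \<notin> {b<..<t}"
      using that by (auto simp: star_level_def)
    ultimately show "interior ({l..r} \<times> {b..t}) \<inter> C = {}"
      by (auto simp: interior_Times star_bar_def)
  qed
  have sees: "bars_see \<B> (star_bar (h, 3)) (star_bar (h, s))"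
    if "l < r" "(b, t) = (0, 1) \<or> (b, t) = (- 1, 0)"
      "{l..r} \<times> {b} \<subseteq> star_bar (h, 3) \<and> {l..r} \<times> {t} \<subseteq> star_bar (h, s) \<or>
       {l..r} \<times> {b} \<subseteq> star_bar (h, s) \<and> {l..r} \<times> {t} \<subseteq> star_bar (h, 3)" for l r b t :: real
  proof -
    have "b < t"
      using that(2) by auto
    then show ?thesis
      unfolding bars_see_def using that(1,3) clear[OF that(2)] by blast
  qed
  have "s = 0 \<or> s = 1 \<or> s = 2"
    using assms(1) by auto
  then show ?thesis
  proof (elim disjE)
    assume "s = 0"
    then show ?thesis
      by (intro sees[of "4 * real h" "4 * real h + 2/5" 0 1])
        (auto simp: star_bar_def star_shift_def star_level_def)
  next
    assume "s = 1"
    then show ?thesis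
      by (intro sees[of "4 * real h + 3/5" "4 * real h + 1" 0 1])
        (auto simp: star_bar_def star_shift_def star_level_def)
  next
    assume "s = 2"
    then show ?thesis
      by (intro sees[of "4 * real h" "4 * real h + 1" "- 1" 0])
        (auto simp: star_bar_def star_shift_def star_level_def)
  qed
qed

text \<open>The midline of the rectangle meets both bars, which puts them in one star. Two leaves at
  different heights are the lower and an upper one; the lower leaf lies exactly under the centre, so
  the centre cuts the rectangle. This is why the centre must belong to the arrangement.\<close>

lemma star_bars_see_imp:
  assumes "l < r" "b < t" "{l..r} \<times> {b} \<subseteq> star_bar p" "{l..r} \<times> {t} \<subseteq> star_bar q"
    and clear: "\<forall>C\<in>\<B>. interior ({l..r} \<times> {b..t}) \<inter> C = {}"
    and center: "star_bar (fst p, 3) \<in> \<B>" and "snd p \<le> 3" "snd q \<le> 3"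
  shows "fst p = fst q \<and> (snd p = 3) \<noteq> (snd q = 3)"
proof -
  let ?x = "(l + r) / 2"
  have x: "l < ?x" "?x < r"
    using assms(1) by auto
  then have "(?x, b) \<in> star_bar p" "(?x, t) \<in> star_bar q"
    using assms(3,4) by auto
  then have xp: "?x \<in> {4 * real (fst p) + star_shift (snd p)..4 * real (fst p) + star_shift (snd p) + 1}"
    and xq: "?x \<in> {4 * real (fst q) + star_shift (snd q)..4 * real (fst q) + star_shift (snd q) + 1}"
    and y: "star_level (snd p) = b" "star_level (snd q) = t"
    unfolding star_bar_def by (simp_all add: mem_Times_iff)
  have h: "fst p = fst q"
    using star_bar_overlap[OF xp xq] .
  have "(snd p = 3) \<noteq> (snd q = 3)"
  proof (rule ccontr)
    assume "\<not> ?thesis"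
    then have s: "snd p = 2" "b = - 1" "t = 1"
      using y assms(2) by (auto simp: star_level_def split: if_splits)
    have "(?x, 0) \<in> star_bar (fst p, 3)"
      using xp s by (simp add: star_bar_def star_shift_def star_level_def)
    moreover have "(?x, 0) \<in> interior ({l..r} \<times> {b..t})"
      using x s by (simp add: interior_Times)
    ultimately show False
      using bspec[OF clear center] by (metis IntI empty_iff)
  qed
  with h show ?thesis by (rule conjI)
qed

lemma star_bars_see_iff:
  assumes "p \<in> S" "q \<in> S"
    and slots: "\<And>p. p \<in> S \<Longrightarrow> snd p \<le> 3" and centers: "\<And>p. p \<in> S \<Longrightarrow> (fst p, 3) \<in> S"
  shows "bars_see (star_bar ` S) (star_bar p) (star_bar q) \<longleftrightarrow>
    fst p = fst q \<and> (snd p = 3) \<noteq> (snd q = 3)"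
proof
  assume "bars_see (star_bar ` S) (star_bar p) (star_bar q)"
  then obtain l r b t where "l < r" "b < t"
    and sub: "{l..r} \<times> {b} \<subseteq> star_bar p \<and> {l..r} \<times> {t} \<subseteq> star_bar q \<or>
      {l..r} \<times> {b} \<subseteq> star_bar q \<and> {l..r} \<times> {t} \<subseteq> star_bar p"
    and clear: "\<forall>C\<in>star_bar ` S. interior ({l..r} \<times> {b..t}) \<inter> C = {}"
    unfolding bars_see_def by blast
  from sub show "fst p = fst q \<and> (snd p = 3) \<noteq> (snd q = 3)"
  proof (elim disjE conjE)
    assume "{l..r} \<times> {b} \<subseteq> star_bar p" "{l..r} \<times> {t} \<subseteq> star_bar q"
    then show ?thesis
      by (intro star_bars_see_imp[OF \<open>l < r\<close> \<open>b < t\<close> _ _ clear]) (use assms in auto)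
  next
    assume "{l..r} \<times> {b} \<subseteq> star_bar q" "{l..r} \<times> {t} \<subseteq> star_bar p"
    then have "fst q = fst p \<and> (snd q = 3) \<noteq> (snd p = 3)"
      by (intro star_bars_see_imp[OF \<open>l < r\<close> \<open>b < t\<close> _ _ clear]) (use assms in auto)
    then show ?thesis by auto
  qed
next
  assume pq: "fst p = fst q \<and> (snd p = 3) \<noteq> (snd q = 3)"
  have sees: "bars_see (star_bar ` S) (star_bar c) (star_bar d)"
    if "fst c = fst d" "snd c = 3" "snd d \<noteq> 3" "d \<in> S" for c d
  proof -
    have "snd d < 3"
      using slots[OF that(4)] that(3) by simp
    then show ?thesis
      using center_sees_leaf[of "snd d" "star_bar ` S" "fst d"] that by (metis image_mono prod.collapse subset_UNIV)
  qed
  from pq show "bars_see (star_bar ` S) (star_bar p) (star_bar q)"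
    using sees[of p q] sees[of q p] assms(1,2) bars_see_commute by metis
qed

text \<open>This removes the geometry: a vertex owns pairs of a star and a slot, and adjacency means
  owning the centre and a leaf of a common star.\<close>

lemma unit_bar_visibility_rep_of_slots:
  fixes slots :: "'a \<Rightarrow> (nat \<times> nat) set"
  assumes fin: "\<And>v. v \<in> pverts G \<Longrightarrow> finite (slots v) \<and> card (slots v) \<le> t"
    and bound: "\<And>v p. v \<in> pverts G \<Longrightarrow> p \<in> slots v \<Longrightarrow> snd p \<le> 3"
    and disj: "\<And>u v. u \<in> pverts G \<Longrightarrow> v \<in> pverts G \<Longrightarrow> u \<noteq> v \<Longrightarrow> slots u \<inter> slots v = {}"
    and center: "\<And>v p. v \<in> pverts G \<Longrightarrow> p \<in> slots v \<Longrightarrow> \<exists>w\<in>pverts G. (fst p, 3) \<in> slots w"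
    and adj: "\<And>u v. u \<in> pverts G \<Longrightarrow> v \<in> pverts G \<Longrightarrow> u \<noteq> v \<Longrightarrow> (u, v) \<in> parcs G \<longleftrightarrow>
      (\<exists>p\<in>slots u. \<exists>q\<in>slots v. fst p = fst q \<and> (snd p = 3) \<noteq> (snd q = 3))"
  shows "unit_bar_visibility_rep t G (\<lambda>v. star_bar ` slots v)"
  unfolding unit_bar_visibility_rep_def
proof (intro conjI ballI impI)
  fix v assume v: "v \<in> pverts G"
  show "finite (star_bar ` slots v)"
    using fin[OF v] by simp
  show "card (star_bar ` slots v) \<le> t"
    using fin[OF v] card_image_le by (meson order_trans)
  fix B assume "B \<in> star_bar ` slots v"
  then show "unit_bar B"
    using unit_bar_star_bar by blast
next
  fix u v A B
  assume uv: "u \<in> pverts G" "v \<in> pverts G" and A: "A \<in> star_bar ` slots u" and B: "B \<in> star_bar ` slots v"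
    and ne: "(u, A) \<noteq> (v, B)"
  obtain p where p: "p \<in> slots u" "A = star_bar p"
    using A by blast
  obtain q where q: "q \<in> slots v" "B = star_bar q"
    using B by blast
  have "p \<noteq> q"
    using ne p q disj[OF uv] by blast
  then show "A \<inter> B = {}"
    unfolding p(2) q(2) by (rule star_bar_disjoint[OF bound[OF uv(1) p(1)] bound[OF uv(2) q(1)]])
next
  fix u v assume uv: "u \<in> pverts G" "v \<in> pverts G" "u \<noteq> v"
  let ?S = "\<Union>w\<in>pverts G. slots w"
  have S: "(\<Union>w\<in>pverts G. star_bar ` slots w) = star_bar ` ?S"
    by blast
  have "bars_see (star_bar ` ?S) (star_bar p) (star_bar q) \<longleftrightarrow> fst p = fst q \<and> (snd p = 3) \<noteq> (snd q = 3)"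
    if "p \<in> slots u" "q \<in> slots v" for p q
  proof (rule star_bars_see_iff)
    show "snd p' \<le> 3" if "p' \<in> ?S" for p'
      using that bound by blast
    show "(fst p', 3) \<in> ?S" if "p' \<in> ?S" for p'
      using that center by blast
  qed (use that uv in auto)
  then show "((u, v) \<in> parcs G) =
      (\<exists>A\<in>star_bar ` slots u. \<exists>B\<in>star_bar ` slots v.
        bars_see (\<Union>w\<in>pverts G. star_bar ` slots w) A B)"
    unfolding S adj[OF uv] by blast
qed

section \<open>Planar graphs\<close>

context pair_graph
begin

lemma undirected_edges_iff: "{u, v} \<in> undirected_edges G \<longleftrightarrow> (u, v) \<in> parcs G"
  using arcs_symmetric by (auto simp: undirected_edges_def doubleton_eq_iff)

lemma undirected_edgeE:
  assumes "e \<in> undirected_edges G"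
  obtains u v where "e = {u, v}" "u \<noteq> v" "(u, v) \<in> parcs G" "u \<in> pverts G" "v \<in> pverts G"
  using assms pair_no_loops in_arcsD1 in_arcsD2 unfolding undirected_edges_def by fastforce

lemma finite_undirected_edges: "finite (undirected_edges G)"
proof -
  have "undirected_edges G = (\<lambda>(u, v). {u, v}) ` parcs G"
    by (auto simp: undirected_edges_def)
  then show ?thesis
    using pair_finite_arcs by simp
qed

section \<open>Orienting a planar graph\<close>

lemma arc_drawing_of_plane_drawing:
  assumes "plane_drawing G pos \<gamma>"
  shows "arc_drawing (pverts G) (undirected_edges G) pos \<gamma>"
proof
  fix e assume e: "e \<in> undirected_edges G"
  show "e \<subseteq> pverts G" "card e = 2"
    using e by (auto elim!: undirected_edgeE)
  show "Path_Connected.arc (\<gamma> e)" "{pathstart (\<gamma> e), pathfinish (\<gamma> e)} = pos ` e"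
    "path_image (\<gamma> e) \<inter> pos ` pverts G = pos ` e"
    using assms e unfolding plane_drawing_def by blast+
  fix e' assume "e' \<in> undirected_edges G" "e \<noteq> e'"
  with e assms show "path_image (\<gamma> e) \<inter> path_image (\<gamma> e') \<subseteq> pos ` (e \<inter> e')"
    unfolding plane_drawing_def by blast
qed (rule pair_finite_verts)

text \<open>Hall's theorem is applied with each edge as its own set of candidates; the chosen end
  \<open>f e\<close> is the tail.\<close>

lemma planar_orientation:
  assumes "planar G"
  obtains f where "\<And>e. e \<in> undirected_edges G \<Longrightarrow> f e \<in> e"
    and "\<And>v. card {e \<in> undirected_edges G. f e = v} \<le> 3"
proof -
  obtain pos \<gamma> where "plane_drawing G pos \<gamma>"
    using assms unfolding planar_def by blast
  then interpret arc_drawing "pverts G" "undirected_edges G" pos \<gamma>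
    by (rule arc_drawing_of_plane_drawing)
  have "\<exists>f. (\<forall>e\<in>undirected_edges G. f e \<in> e) \<and> (\<forall>v. card {e \<in> undirected_edges G. f e = v} \<le> 3)"
  proof (rule capacitated_Hall[where A = "\<lambda>e. e", simplified image_ident])
    show "finite e" if "e \<in> undirected_edges G" for e
      using card_edge[OF that] card.infinite by fastforce
  qed (use finite_undirected_edges card_subset_edges_le in auto)
  then show ?thesis
    using that by blast
qed

section \<open>Degrees and the assembly of the stars\<close>

lemma card_incident_edges_le: "card {e \<in> undirected_edges G. v \<in> e} \<le> out_degree (with_proj G) v"
proof -
  have "{e \<in> undirected_edges G. v \<in> e} \<subseteq> (\<lambda>(a, b). {a, b}) ` out_arcs (with_proj G) v"
  proof
    fix e assume "e \<in> {e \<in> undirected_edges G. v \<in> e}"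
    then obtain a b where ab: "e = {a, b}" "(a, b) \<in> parcs G" "v \<in> e"
      by (auto simp: undirected_edges_def)
    have "(b, a) \<in> parcs G"
      using ab(2) arcs_symmetric by blast
    with ab show "e \<in> (\<lambda>(a, b). {a, b}) ` out_arcs (with_proj G) v"
      by (cases "v = a") (force simp: out_arcs_def insert_commute)+
  qed
  moreover have "finite (out_arcs (with_proj G) v)"
    using pair_finite_arcs by (auto simp: out_arcs_def)
  ultimately show ?thesis
    unfolding out_degree_def by (meson card_image_le card_mono finite_imageI order_trans)
qed

lemma out_degree_le_max_degree: "v \<in> pverts G \<Longrightarrow> out_degree (with_proj G) v \<le> max_degree G"
  unfolding max_degree_def using pair_finite_verts by (intro Max_ge) auto

text \<open>Each edge becomes a leaf bar of \<open>f e\<close> in a star centred at the other endpoint of \<open>e\<close>. Three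
  edges share a centre bar, so \<open>v\<close> needs \<open>o\<close> leaf bars and \<open>\<lceil>(d - o) / 3\<rceil>\<close> centre bars, where
  \<open>o \<le> 3\<close> and \<open>d\<close> is the degree.\<close>
lemma visibility_rep_of_orientation:
  assumes f: "\<And>e. e \<in> undirected_edges G \<Longrightarrow> f e \<in> e"
    and out: "\<And>v. card {e \<in> undirected_edges G. f e = v} \<le> 3"
  shows "\<exists>bars. unit_bar_visibility_rep ((max_degree G + 2) div 3 + 2) G bars"
proof -
  let ?E = "undirected_edges G"
  define c where "c e = the_elem (e - {f e})" for e
  have c: "e = {f e, c e}" "f e \<noteq> c e" "f e \<in> pverts G" "c e \<in> pverts G" if e: "e \<in> ?E" for e
  proof -
    obtain u v where uv: "e = {u, v}" "u \<noteq> v" "u \<in> pverts G" "v \<in> pverts G"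
      using undirected_edgeE[OF e] by metis
    then have "f e = u \<or> f e = v"
      using f[OF e] by blast
    then have "e = {f e, c e} \<and> f e \<noteq> c e \<and> f e \<in> pverts G \<and> c e \<in> pverts G"
    proof
      assume fe: "f e = u"
      then have "e - {f e} = {v}"
        using uv by auto
      then have "c e = v"
        by (simp add: c_def)
      with fe uv show ?thesis by simp
    next
      assume fe: "f e = v"
      then have "e - {f e} = {u}"
        using uv by auto
      then have "c e = u"
        by (simp add: c_def)
      with fe uv show ?thesis by (simp add: insert_commute)
    qed
    then show "e = {f e, c e}" "f e \<noteq> c e" "f e \<in> pverts G" "c e \<in> pverts G"
      by blast+
  qed
  define Inn where "Inn v = {e \<in> ?E. c e = v}" for v
  define Out where "Out v = {e \<in> ?E. f e = v}" for v
  have fin: "finite (Inn v)" "finite (Out v)" for v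
    using finite_undirected_edges by (auto simp: Inn_def Out_def)
  have "\<exists>i. bij_betw i (Inn v) {0..<card (Inn v)}" for v
    using ex_bij_betw_finite_nat[OF fin(1)] by blast
  then obtain i where i: "\<And>v. bij_betw (i v) (Inn v) {0..<card (Inn v)}"
    by metis
  obtain n :: "'a \<Rightarrow> nat" where n: "inj_on n (pverts G)"
    using finite_imp_inj_to_nat_seg[OF pair_finite_verts] by blast
  \<comment> \<open>A vertex owns several stars; the pairing function gives all stars of all
    vertices different indices.\<close>
  define H where "H v k = prod_encode (n v, k)" for v k
  have H: "H u k = H v l \<longleftrightarrow> u = v \<and> k = l" if "u \<in> pverts G" "v \<in> pverts G" for u v k l
    using n that by (auto simp: H_def dest: inj_onD)
  define num where "num v = (card (Inn v) + 2) div 3" for v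
  define center where "center v k = (H v k, 3::nat)" for v k
  \<comment> \<open>The in-edges of a vertex are numbered from 0 and dealt out in threes: the
    quotient selects the star, the remainder one of the leaf slots 0, 1, 2, never the centre slot
    3.\<close>
  define leaf where "leaf e = (H (c e) (i (c e) e div 3), i (c e) e mod 3)" for e
  define slots where "slots v = center v ` {..<num v} \<union> leaf ` Out v" for v
  have leaf_slot: "snd (leaf e) < 3" for e
    by (simp add: leaf_def)
  have leaf_center: "center (c e) (i (c e) e div 3) \<in> slots (c e)" if "e \<in> ?E" for e
  proof -
    have "i (c e) e < card (Inn (c e))"
      using bij_betwE[OF i[of "c e"]] that by (auto simp: Inn_def)
    then have "i (c e) e div 3 < num (c e)"
      unfolding num_def by linarith
    then show ?thesis
      by (auto simp: slots_def)
  qed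
  have leaf_inj: "e = e'" if "e \<in> ?E" "e' \<in> ?E" "leaf e = leaf e'" for e e'
  proof -
    have eq: "c e = c e'" "i (c e) e div 3 = i (c e') e' div 3" "i (c e) e mod 3 = i (c e') e' mod 3"
      using that(3) H[OF c(4)[OF that(1)] c(4)[OF that(2)]] by (auto simp: leaf_def)
    then have "i (c e) e = i (c e) e'"
      by (metis div_mult_mod_eq)
    moreover have "e \<in> Inn (c e)" "e' \<in> Inn (c e)"
      using that eq(1) by (auto simp: Inn_def)
    ultimately show ?thesis
      using i[of "c e"] by (auto simp: bij_betw_def dest: inj_onD)
  qed
  have slotsE: "(\<exists>k. p = center v k) \<or> (\<exists>e. e \<in> ?E \<and> f e = v \<and> p = leaf e)" if "p \<in> slots v" for p v
    using that by (auto simp: slots_def Out_def)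
  have slot3: "snd (center v k) = 3" for v k
    by (simp add: center_def)
  have "unit_bar_visibility_rep ((max_degree G + 2) div 3 + 2) G (\<lambda>v. star_bar ` slots v)"
  proof (rule unit_bar_visibility_rep_of_slots)
    fix v assume v: "v \<in> pverts G"
    have "card (slots v) \<le> num v + card (Out v)"
    proof -
      have "card (slots v) \<le> card (center v ` {..<num v}) + card (leaf ` Out v)"
        unfolding slots_def by (rule card_Un_le)
      also have "\<dots> \<le> num v + card (Out v)"
        using card_image_le[of "{..<num v}" "center v"] card_image_le[OF fin(2), of leaf v]
        by simp
      finally show ?thesis .
    qed
    moreover have "card (Inn v) + card (Out v) \<le> max_degree G"
    proof -
      have "Inn v \<inter> Out v = {}"
        using c(2) by (auto simp: Inn_def Out_def)
      then have "card (Inn v) + card (Out v) = card (Inn v \<union> Out v)"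
        using fin by (simp add: card_Un_disjoint)
      also have "\<dots> \<le> card {e \<in> ?E. v \<in> e}"
        using finite_undirected_edges c(1) by (intro card_mono) (auto simp: Inn_def Out_def)
      finally show ?thesis
        using card_incident_edges_le[of v] out_degree_le_max_degree[OF v] by linarith
    qed
    moreover have "card (Out v) \<le> 3"
      using out by (simp add: Out_def)
    \<comment> \<open>Trading an in-edge for an out-edge never lowers the number of bars, so three
      out-edges are the worst case. Their three bars replace one centre bar, whence the added
      2.\<close>
    ultimately have "card (slots v) \<le> (max_degree G + 2) div 3 + 2"
      unfolding num_def by linarith
    then show "finite (slots v) \<and> card (slots v) \<le> (max_degree G + 2) div 3 + 2"
      using fin by (simp add: slots_def)
  next
    fix v p assume "v \<in> pverts G" "p \<in> slots v"
    then show "snd p \<le> 3"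
      using slotsE[of p v] leaf_slot slot3 by (metis le_less order_refl)
  next
    fix u v assume uv: "u \<in> pverts G" "v \<in> pverts G" "u \<noteq> v"
    show "slots u \<inter> slots v = {}"
    proof (rule equals0I)
      fix p assume "p \<in> slots u \<inter> slots v"
      then have "(\<exists>k. p = center u k) \<or> (\<exists>e. e \<in> ?E \<and> f e = u \<and> p = leaf e)"
        and "(\<exists>k. p = center v k) \<or> (\<exists>e. e \<in> ?E \<and> f e = v \<and> p = leaf e)"
        using slotsE by blast+
      then consider k l where "center u k = center v l"
        | k e where "center u k = leaf e" | k e where "center v k = leaf e"
        | e e' where "e \<in> ?E" "f e = u" "e' \<in> ?E" "f e' = v" "leaf e = leaf e'"
        by metis
      then show False
      proof cases
        case 1
        then show False
          using H[OF uv(1,2)] uv(3) by (simp add: center_def)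
      next
        case 2
        then show False
          by (metis leaf_slot slot3 less_irrefl)
      next
        case 3
        then show False
          by (metis leaf_slot slot3 less_irrefl)
      next
        case 4
        then show False
          using leaf_inj uv(3) by blast
      qed
    qed
  next
    fix v p assume v: "v \<in> pverts G" and p: "p \<in> slots v"
    from slotsE[OF p] show "\<exists>w\<in>pverts G. (fst p, 3) \<in> slots w"
    proof (elim disjE exE conjE)
      fix k assume k: "p = center v k"
      then have "(fst p, 3) = p"
        by (simp add: center_def)
      with v p show ?thesis by metis
    next
      fix e assume e: "e \<in> ?E" "p = leaf e"
      then have "(fst p, 3) = center (c e) (i (c e) e div 3)"
        by (simp add: center_def leaf_def)
      with leaf_center[OF e(1)] c(4)[OF e(1)] show ?thesis by metis
    qed
  next
    fix u v assume uv: "u \<in> pverts G" "v \<in> pverts G" "u \<noteq> v"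
    \<comment> \<open>No unwanted visibility arises: a leaf in a star of \<open>x\<close> stems from
      an edge whose other end is \<open>x\<close>.\<close>
    have edge: "(x, y) \<in> parcs G \<and> (y, x) \<in> parcs G"
      if asm: "x \<in> pverts G" "p \<in> slots x" "q \<in> slots y" "fst p = fst q" "snd p = 3" "snd q \<noteq> 3" for x y p q
    proof -
      obtain k where k: "p = center x k"
        using slotsE[OF asm(2)] leaf_slot asm(5) by (metis less_irrefl)
      obtain e where e: "e \<in> ?E" "f e = y" "q = leaf e"
        using slotsE[OF asm(3)] slot3 asm(6) by metis
      have "c e = x"
        using asm(4) H[OF asm(1) c(4)[OF e(1)]] by (simp add: k e(3) center_def leaf_def)
      then have "{x, y} \<in> ?E" "{y, x} \<in> ?E"
        using c(1)[OF e(1)] e by (metis insert_commute)+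
      then show ?thesis
        by (simp add: undirected_edges_iff)
    qed
    show "(u, v) \<in> parcs G \<longleftrightarrow>
      (\<exists>p\<in>slots u. \<exists>q\<in>slots v. fst p = fst q \<and> (snd p = 3) \<noteq> (snd q = 3))"
    proof
      assume "(u, v) \<in> parcs G"
      then have e: "{u, v} \<in> ?E"
        by (simp add: undirected_edges_iff)
      let ?e = "{u, v}"
      have mem: "leaf ?e \<in> slots (f ?e)" "center (c ?e) (i (c ?e) ?e div 3) \<in> slots (c ?e)"
        using e leaf_center[OF e] by (auto simp: slots_def Out_def)
      have same: "fst (leaf ?e) = fst (center (c ?e) (i (c ?e) ?e div 3))"
        by (simp add: leaf_def center_def)
      have "f ?e = u \<and> c ?e = v \<or> f ?e = v \<and> c ?e = u"
        using c(1)[OF e] by (metis doubleton_eq_iff)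
      then show "\<exists>p\<in>slots u. \<exists>q\<in>slots v. fst p = fst q \<and> (snd p = 3) \<noteq> (snd q = 3)"
        using mem same leaf_slot[of ?e] slot3 by (metis less_irrefl)
    next
      assume "\<exists>p\<in>slots u. \<exists>q\<in>slots v. fst p = fst q \<and> (snd p = 3) \<noteq> (snd q = 3)"
      then obtain p q where pq: "p \<in> slots u" "q \<in> slots v" "fst p = fst q" "(snd p = 3) \<noteq> (snd q = 3)"
        by blast
      show "(u, v) \<in> parcs G"
      proof (cases "snd p = 3")
        case True
        with pq have "snd q \<noteq> 3" by simp
        then show ?thesis
          using edge[OF uv(1) pq(1,2,3) True] by blast
      next
        case False
        with pq have "snd q = 3" by simp
        then show ?thesis
          using edge[OF uv(2) pq(2,1) pq(3)[symmetric] _ False] by blast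
      qed
    qed
  qed
  then show ?thesis by blast
qed

end

theorem theorem11:
  fixes G :: "'a pair_pre_digraph"
  assumes "pair_graph G"
    and "planar G"
  shows "ub G \<le> enat (nat \<lceil>(real (max_degree G) + 1) / 3\<rceil> + 2)"
proof -
  interpret pair_graph G
    by (rule assms(1))
  obtain f where f: "\<And>e. e \<in> undirected_edges G \<Longrightarrow> f e \<in> e"
    "\<And>v. card {e \<in> undirected_edges G. f e = v} \<le> 3"
    using planar_orientation[OF assms(2)] by metis
  obtain bars where "unit_bar_visibility_rep ((max_degree G + 2) div 3 + 2) G bars"
    using visibility_rep_of_orientation[of f] f by blast
  then have "ub G \<le> enat ((max_degree G + 2) div 3 + 2)"
    unfolding ub_def by (intro Inf_lower) blast
  \<comment> \<open>The left side is a third of the maximum degree, rounded up, so the ceiling of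
    the larger quotient dominates it.\<close>
  also have "(max_degree G + 2) div 3 \<le> nat \<lceil>(real (max_degree G) + 1) / 3\<rceil>"
  proof -
    define q where "q = (max_degree G + 2) div 3"
    have "real (3 * q) \<le> real (max_degree G + 2)"
      by (rule of_nat_mono) (simp add: q_def)
    then have "int q \<le> \<lceil>(real (max_degree G) + 1) / 3\<rceil>"
      by (simp add: le_ceiling_iff)
    then show ?thesis
      unfolding q_def by linarith
  qed
  then have "enat ((max_degree G + 2) div 3 + 2) \<le> enat (nat \<lceil>(real (max_degree G) + 1) / 3\<rceil> + 2)"
    by simp
  finally show ?thesis .
qed

end
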